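(* For any integer $\gamma \geq 0$, $\mathsf{Dias}_\gamma$ is a basic operad.
   Context: Write $[\gamma] = \{1, \dots, \gamma\}$. A set-operad is a nonsymmetric operad in sets, described by partial compositions $\circ_i$ and a unit. $\mathsf{Dias}_\gamma$ is the set-operad generated by the two-letter words $0a$ and $a0$, $a \in [\gamma]$, inside the set-operad $\mathsf{T}\mathcal{M}_\gamma$ whose elements of arity $n \ge 1$ are all words of length $n$ on $\{0\} \cup [\gamma]$, with partial compositions $u \circ_i v := u_1 \dots u_{i-1}\,\max(u_i, v_1) \dots \max(u_i, v_m)\, u_{i+1} \dots u_n$ and unit the word $0$. For an operad $\mathcal{O}$, $x \in \mathcal{O}(n)$ and $y_1, \dots, y_n \in \mathcal{O}$, the composition map is $x \circ (y_1, \dots, y_n) := (\dots((x \circ_n y_n) \circ_{n-1} y_{n-1}) \dots) \circ_1 y_1$. A set-operad $\mathcal{O}$ is basic if for all $n \geq 1$ and all $y_1, \dots, y_n \in \mathcal{O}$, the map $\mathcal{O}(n) \to \mathcal{O}(|y_1| + \dots + |y_n|)$, $x \mapsto x \circ (y_1, \dots, y_n)$, is injective, where $|y|$ denotes the arity of $y$. *)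

theory Defs
  imports Main
begin

text \<open>
  Nonsymmetric set-operads. The graded set \<open>(O(n))\<close>, \<open>n \<ge> 1\<close>, is given as the disjoint union
  \<open>elements\<close> of its components together with an \<open>arity\<close> function; \<open>pcomp P x i y\<close> is the
  partial composition of \<open>y\<close> into the \<open>i\<close>-th input of \<open>x\<close>, with inputs numbered from 1.
  It is only constrained for \<open>1 \<le> i \<le> arity x\<close> and \<open>x\<close>, \<open>y\<close> in the operad.
\<close>

record 'a set_operad =
  elements :: "'a set"
  arity :: "'a \<Rightarrow> nat"
  pcomp :: "'a \<Rightarrow> nat \<Rightarrow> 'a \<Rightarrow> 'a"
  opunit :: 'a

definition component :: "('a, 'm) set_operad_scheme \<Rightarrow> nat \<Rightarrow> 'a set" where
  "component P n = {x \<in> elements P. arity P x = n}"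

locale ns_set_operad =
  fixes P :: "('a, 'm) set_operad_scheme"
  assumes arity_pos: "x \<in> elements P \<Longrightarrow> 1 \<le> arity P x"
    and unit_closed: "opunit P \<in> component P 1"
    and pcomp_closed:
      "\<lbrakk>x \<in> component P n; y \<in> component P m; 1 \<le> i; i \<le> n\<rbrakk>
        \<Longrightarrow> pcomp P x i y \<in> component P (n + m - 1)"
    and unit_left: "x \<in> elements P \<Longrightarrow> pcomp P (opunit P) 1 x = x"
    and unit_right:
      "\<lbrakk>x \<in> component P n; 1 \<le> i; i \<le> n\<rbrakk> \<Longrightarrow> pcomp P x i (opunit P) = x"
    and series_assoc:
      "\<lbrakk>x \<in> component P n; y \<in> component P m; z \<in> elements P;
        1 \<le> i; i \<le> n; 1 \<le> j; j \<le> m\<rbrakk>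
        \<Longrightarrow> pcomp P (pcomp P x i y) (i + j - 1) z = pcomp P x i (pcomp P y j z)"
    and parallel_assoc:
      "\<lbrakk>x \<in> component P n; y \<in> component P m; z \<in> elements P;
        1 \<le> i; i < j; j \<le> n\<rbrakk>
        \<Longrightarrow> pcomp P (pcomp P x i y) (j + m - 1) z = pcomp P (pcomp P x j z) i y"

text \<open>
  The composition map: \<open>foldr\<close> inserts the last entry of \<open>ys\<close> first, so
  \<open>full_comp P x [y1, ..., yn]\<close> is
  \<open>pcomp P (... (pcomp P (pcomp P x n yn) (n - 1) y(n-1)) ...) 1 y1\<close>.
\<close>

definition full_comp :: "('a, 'm) set_operad_scheme \<Rightarrow> 'a \<Rightarrow> 'a list \<Rightarrow> 'a" where
  "full_comp P x ys =
     foldr (\<lambda>(i, y) u. pcomp P u i y) (zip [1..<Suc (length ys)] ys) x"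

locale basic_set_operad = ns_set_operad +
  assumes full_comp_inj:
    "\<lbrakk>1 \<le> n; length ys = n; set ys \<subseteq> elements P\<rbrakk>
      \<Longrightarrow> inj_on (\<lambda>x. full_comp P x ys) (component P n)"

inductive_set generated :: "('a, 'm) set_operad_scheme \<Rightarrow> 'a set \<Rightarrow> 'a set"
  for P :: "('a, 'm) set_operad_scheme" and G :: "'a set" where
  unit: "opunit P \<in> generated P G"
| gen: "g \<in> G \<Longrightarrow> g \<in> generated P G"
| comp: "\<lbrakk>x \<in> generated P G; y \<in> generated P G; 1 \<le> i; i \<le> arity P x\<rbrakk>
    \<Longrightarrow> pcomp P x i y \<in> generated P G"

definition generated_suboperad ::
    "('a, 'm) set_operad_scheme \<Rightarrow> 'a set \<Rightarrow> ('a, 'm) set_operad_scheme" where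
  "generated_suboperad P G = P\<lparr>elements := generated P G\<rparr>"

text \<open>Words are lists, with list positions counted from 0 and operadic inputs from 1.\<close>

definition word_pcomp :: "nat list \<Rightarrow> nat \<Rightarrow> nat list \<Rightarrow> nat list" where
  "word_pcomp u i v = take (i - 1) u @ map (max (u ! (i - 1))) v @ drop i u"

definition TM :: "nat \<Rightarrow> nat list set_operad" where
  "TM \<gamma> = \<lparr>elements = {u. 1 \<le> length u \<and> set u \<subseteq> {0} \<union> {1..\<gamma>}},
           arity = length, pcomp = word_pcomp, opunit = [0]\<rparr>"

definition Dias :: "nat \<Rightarrow> nat list set_operad" where
  "Dias \<gamma> = generated_suboperad (TM \<gamma>)
     ({[0, a] | a. a \<in> {1..\<gamma>}} \<union> {[a, 0] | a. a \<in> {1..\<gamma>}})"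

end

theory Submission imports Defs begin

text \<open>
  Every word of \<open>Dias \<gamma>\<close> contains the letter \<open>0\<close>: this holds for the unit and the generators,
  and is preserved by partial composition. The word \<open>x \<circ> (y\<^sub>1, \<dots>, y\<^sub>n)\<close> is the concatenation of the
  blocks \<open>max(x\<^sub>i, y\<^sub>i)\<close>, and the position of a \<open>0\<close> in \<open>y\<^sub>i\<close> carries the letter \<open>x\<^sub>i\<close> in the
  \<open>i\<close>-th block, so that \<open>x\<close> can be read off the composite.
\<close>

text \<open>Once \<open>generated P G\<close> is known to lie in \<open>elements P\<close>, the
  equational axioms restrict from \<open>P\<close>; closure and the presence of the unit come from
  the rules \<open>generated.comp\<close> and \<open>generated.unit\<close>.\<close>

lemma ns_set_operad_generated_suboperad:
  assumes "ns_set_operad P" "G \<subseteq> elements P"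
  shows "ns_set_operad (generated_suboperad P G)"
proof -
  interpret ns_set_operad P by fact
  have sub: "x \<in> elements P" if "x \<in> generated P G" for x
    using that
  proof induction
    case unit
    then show ?case using unit_closed by (simp add: component_def)
  next
    case (gen g)
    then show ?case using assms(2) by blast
  next
    case (comp x y i)
    then show ?case
      using pcomp_closed[of x "arity P x" y "arity P y" i] by (simp add: component_def)
  qed
  let ?Q = "generated_suboperad P G"
  have sel: "elements ?Q = generated P G" "arity ?Q = arity P" "pcomp ?Q = pcomp P"
    "opunit ?Q = opunit P"
    by (simp_all add: generated_suboperad_def)
  have comp_iff: "x \<in> component ?Q n \<longleftrightarrow> x \<in> component P n \<and> x \<in> generated P G" for x n
    by (auto simp: component_def sel sub)
  show ?thesis
  proof (unfold_locales, unfold sel comp_iff)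
    fix x y n m i
    assume "x \<in> component P n \<and> x \<in> generated P G" "y \<in> component P m \<and> y \<in> generated P G"
      "1 \<le> i" "i \<le> n"
    then show "pcomp P x i y \<in> component P (n + m - 1) \<and> pcomp P x i y \<in> generated P G"
      using pcomp_closed[of x n y m i] generated.comp[of x P G y i]
      by (simp add: component_def)
  qed (blast intro: arity_pos unit_closed generated.unit unit_left unit_right series_assoc
      parallel_assoc sub)+
qed

text \<open>Together with \<open>split_at_input\<close>, this trades \<open>take\<close> and
  \<open>drop\<close> for a splitting of the word around its \<open>i\<close>-th letter, so that the
  computations below become list algebra.\<close>

lemma word_pcomp_append:
  "i = Suc (length p) \<Longrightarrow> word_pcomp (p @ a # s) i v = p @ map (max a) v @ s"
  by (simp add: word_pcomp_def)

lemma split_at_input: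
  assumes "1 \<le> i" "i \<le> length u"
  obtains p a s where "u = p @ a # s" "i = Suc (length p)"
proof
  show "u = take (i - 1) u @ u ! (i - 1) # drop i u"
    using assms id_take_nth_drop[of "i - 1" u] by simp
  show "i = Suc (length (take (i - 1) u))"
    using assms by simp
qed

text \<open>Rests on associativity of \<open>max\<close>: on either side a letter \<open>c\<close>
  of \<open>z\<close> becomes the maximum of \<open>a\<close>, \<open>b\<close> and
  \<open>c\<close>.\<close>

lemma word_pcomp_series:
  assumes "1 \<le> i" "i \<le> length x" "1 \<le> j" "j \<le> length y"
  shows "word_pcomp (word_pcomp x i y) (i + j - 1) z = word_pcomp x i (word_pcomp y j z)"
proof -
  obtain p a s where x: "x = p @ a # s" "i = Suc (length p)"
    using assms split_at_input by blast
  obtain q b t where y: "y = q @ b # t" "j = Suc (length q)"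
    using assms split_at_input by blast
  \<comment> \<open>The letter \<open>b\<close> of \<open>y\<close> now reads \<open>max a b\<close>
    and has \<open>length p + length q = i + j - 2\<close> letters before it.\<close>
  have "word_pcomp (word_pcomp x i y) (i + j - 1) z
      = word_pcomp ((p @ map (max a) q) @ max a b # map (max a) t @ s) (i + j - 1) z"
    by (simp add: x y word_pcomp_append)
  also have "\<dots> = (p @ map (max a) q) @ map (max (max a b)) z @ map (max a) t @ s"
    by (rule word_pcomp_append) (simp add: x y)
  also have "\<dots> = word_pcomp x i (word_pcomp y j z)"
    by (simp add: x y word_pcomp_append max.assoc)
  finally show ?thesis .
qed

text \<open>The insertions replace two different letters \<open>a\<close> and \<open>b\<close> of
  \<open>x\<close>, so they do not interact; inserting \<open>y\<close> only moves \<open>b\<close>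
  by \<open>length y - 1\<close> places.\<close>

lemma word_pcomp_parallel:
  assumes "1 \<le> i" "i < j" "j \<le> length x"
  shows "word_pcomp (word_pcomp x i y) (j + length y - 1) z = word_pcomp (word_pcomp x j z) i y"
proof -
  obtain p a r where x: "x = p @ a # r" "i = Suc (length p)"
    using assms split_at_input[of i x] by auto
  \<comment> \<open>The \<open>j\<close>-th letter of \<open>x\<close> lies to the right of
    \<open>a\<close>, hence is letter \<open>j - i\<close> of the remainder
    \<open>r\<close>.\<close>
  obtain q b s where r: "r = q @ b # s" "j - i = Suc (length q)"
  proof (rule split_at_input)
    show "1 \<le> j - i" "j - i \<le> length r"
      using assms by (simp_all add: x)
  qed
  have j: "j = Suc (length (p @ a # q))"
    using x r assms by simp
  have "word_pcomp (word_pcomp x i y) (j + length y - 1) z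
      = word_pcomp ((p @ map (max a) y @ q) @ b # s) (j + length y - 1) z"
    by (simp add: x r word_pcomp_append)
  also have "\<dots> = (p @ map (max a) y @ q) @ map (max b) z @ s"
    by (rule word_pcomp_append) (simp add: j)
  also have "\<dots> = word_pcomp (p @ a # (q @ map (max b) z @ s)) i y"
    by (simp add: x word_pcomp_append)
  also have "p @ a # (q @ map (max b) z @ s) = word_pcomp x j z"
    using word_pcomp_append[OF j, of b s z] by (simp add: x r)
  finally show ?thesis .
qed

lemma ns_set_operad_TM: "ns_set_operad (TM \<gamma>)"
proof
  fix x y n m i
  assume x: "x \<in> component (TM \<gamma>) n" and y: "y \<in> component (TM \<gamma>) m" and i: "1 \<le> i" "i \<le> n"
  then obtain p a s where "x = p @ a # s" "i = Suc (length p)"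
    using split_at_input[of i x] by (auto simp: component_def TM_def)
  \<comment> \<open>The maximum of two letters is one of them, so no letter outside the alphabet
    arises.\<close>
  with x y show "pcomp (TM \<gamma>) x i y \<in> component (TM \<gamma>) (n + m - 1)"
    by (auto simp: component_def TM_def word_pcomp_append max_def Suc_le_eq)
next
  fix x n i
  assume "x \<in> component (TM \<gamma>) n" "1 \<le> i" "i \<le> n"
  then obtain p a s where "x = p @ a # s" "i = Suc (length p)"
    using split_at_input[of i x] by (auto simp: component_def TM_def)
  then show "pcomp (TM \<gamma>) x i (opunit (TM \<gamma>)) = x"
    by (simp add: TM_def word_pcomp_append)
next
  fix x
  show "pcomp (TM \<gamma>) (opunit (TM \<gamma>)) 1 x = x"
    by (simp add: TM_def word_pcomp_def map_idI)
next
  fix x y z n m i j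
  assume "x \<in> component (TM \<gamma>) n" "y \<in> component (TM \<gamma>) m" "1 \<le> i" "i \<le> n" "1 \<le> j" "j \<le> m"
  then show "pcomp (TM \<gamma>) (pcomp (TM \<gamma>) x i y) (i + j - 1) z
      = pcomp (TM \<gamma>) x i (pcomp (TM \<gamma>) y j z)"
    using word_pcomp_series[of i x j y z] by (simp add: component_def TM_def)
next
  fix x y z n m i j
  assume "x \<in> component (TM \<gamma>) n" "y \<in> component (TM \<gamma>) m" "1 \<le> i" "i < j" "j \<le> n"
  then show "pcomp (TM \<gamma>) (pcomp (TM \<gamma>) x i y) (j + m - 1) z
      = pcomp (TM \<gamma>) (pcomp (TM \<gamma>) x j z) i y"
    using word_pcomp_parallel[of i j x y z] by (auto simp: component_def TM_def)
qed (auto simp: component_def TM_def)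

lemma zero_mem_Dias:
  assumes "u \<in> elements (Dias \<gamma>)"
  shows "0 \<in> set u"
proof -
  let ?G = "{[0, a] | a. a \<in> {1..\<gamma>}} \<union> {[a, 0] | a. a \<in> {1..\<gamma>}}"
  have "u \<in> generated (TM \<gamma>) ?G"
    using assms by (simp add: Dias_def generated_suboperad_def)
  then show ?thesis
  proof induction
    case (comp x y i)
    then obtain p a s where "x = p @ a # s" "i = Suc (length p)"
      using split_at_input[of i x] by (auto simp: TM_def)
    \<comment> \<open>A \<open>0\<close> of \<open>x\<close> inside \<open>p\<close> or
      \<open>s\<close> survives; otherwise \<open>a = 0\<close>, and the \<open>0\<close> of
      \<open>y\<close> gives \<open>max 0 0 = 0\<close>.\<close>
    with comp show ?case
      by (auto simp: TM_def word_pcomp_append image_iff intro!: bexI[of _ 0])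
  qed (auto simp: TM_def)
qed

text \<open>Insertions run from right to left, so they never shift the inputs still to be filled.
  The prefix \<open>p\<close> of untouched letters makes the shifted indices of the tail fit the
  induction.\<close>

lemma foldr_word_pcomp:
  assumes "length x = length ys"
  shows "foldr (\<lambda>(i, y) u. word_pcomp u i y)
      (zip [Suc (length p)..<Suc (length p + length ys)] ys) (p @ x)
    = p @ concat (map2 (\<lambda>a. map (max a)) x ys)"
  using assms
proof (induction x ys arbitrary: p rule: list_induct2)
  case (Cons a x y ys)
  \<comment> \<open>The first index belongs to the insertion performed last; the others are those of
    the induction hypothesis for the prefix \<open>p @ [a]\<close>.\<close>
  have "[Suc (length p)..<Suc (length p + length (y # ys))]
      = Suc (length p) # [Suc (length (p @ [a]))..<Suc (length (p @ [a]) + length ys)]"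
    by (subst upt_conv_Cons) auto
  with Cons.IH[of "p @ [a]"] show ?case
    by (simp add: word_pcomp_append del: upt_Suc)
qed simp

lemma full_comp_Dias:
  "length x = length ys \<Longrightarrow> full_comp (Dias \<gamma>) x ys = concat (map2 (\<lambda>a. map (max a)) x ys)"
  using foldr_word_pcomp[of x ys "[]"]
  by (simp add: full_comp_def Dias_def generated_suboperad_def TM_def del: upt_Suc)

lemma map_max_inj:
  fixes a b :: nat
  assumes "map (max a) y = map (max b) y" "0 \<in> set y"
  shows "a = b"
  using assms by (metis map_eq_conv max_0R)

text \<open>The block lengths are those of the words in \<open>ys\<close>, the same for
  \<open>x\<close> and \<open>x'\<close>, so equal concatenations agree block by block and
  \<open>map_max_inj\<close> applies to each block.\<close>

lemma concat_map_max_inj: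
  fixes x x' :: "nat list"
  assumes "length x = length x'" "length x' = length ys" "\<forall>y \<in> set ys. 0 \<in> set y"
    and "concat (map2 (\<lambda>a. map (max a)) x ys) = concat (map2 (\<lambda>a. map (max a)) x' ys)"
  shows "x = x'"
  using assms by (induction x x' ys rule: list_induct3) (auto dest: map_max_inj)

theorem proposition2p3p3:
  fixes \<gamma> :: nat
  shows "basic_set_operad (Dias \<gamma>)"
proof (intro basic_set_operad.intro basic_set_operad_axioms.intro)
  show "ns_set_operad (Dias \<gamma>)"
    unfolding Dias_def
    by (intro ns_set_operad_generated_suboperad ns_set_operad_TM) (auto simp: TM_def)
next
  fix n :: nat and ys :: "nat list list"
  assume ys: "length ys = n" "set ys \<subseteq> elements (Dias \<gamma>)"
  have len: "length x = length ys" if "x \<in> component (Dias \<gamma>) n" for x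
    using that ys by (simp add: component_def Dias_def generated_suboperad_def TM_def)
  show "inj_on (\<lambda>x. full_comp (Dias \<gamma>) x ys) (component (Dias \<gamma>) n)"
  proof (rule inj_onI)
    fix x x'
    assume x: "x \<in> component (Dias \<gamma>) n" and x': "x' \<in> component (Dias \<gamma>) n"
      and "full_comp (Dias \<gamma>) x ys = full_comp (Dias \<gamma>) x' ys"
    then have "concat (map2 (\<lambda>a. map (max a)) x ys) = concat (map2 (\<lambda>a. map (max a)) x' ys)"
      using len[OF x] len[OF x'] by (simp add: full_comp_Dias)
    moreover have "\<forall>y \<in> set ys. 0 \<in> set y"
      using ys(2) zero_mem_Dias by blast
    ultimately show "x = x'"
      using len[OF x] len[OF x'] concat_map_max_inj by metis
  qed
qed

end
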